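(* Let $M\rightarrow M'$ be a matroid perspective on a finite linearly ordered set $E$, and let $p,q$ be non-negative integers. Then $$\frac{\partial^{p+q} t}{\partial x^p\,\partial y^q}(M,M';x,y,z)=p!\,q!\sum_{\substack{A\subseteq E\\ cr_{M'}(A)=p,\ nl_M(A)=q}} x^{\iota_{M'}(A)}\,y^{\epsilon_M(A)}\,z^{rcd_{M,M'}(A)}.$$
   Context: A matroid perspective $M\rightarrow M'$ is a pair of matroids $M,M'$ on the same finite set $E$ such that every circuit of $M$ is a union of circuits of $M'$ (equivalently, no circuit of $M$ and cocircuit of $M'$ intersect in exactly one element). For a matroid $N$ on $E$ with rank function $r_N$, $r(N)=r_N(E)$, and $A\subseteq E$: $cr_N(A)=r(N)-r_N(A)$, $nl_N(A)=|A|-r_N(A)$; $\mathrm{Ext}_N(A)$ is the set of $e\in E\setminus A$ that are the smallest element of some circuit of $N$ contained in $A\cup\{e\}$, $\epsilon_N(A)=|\mathrm{Ext}_N(A)|$; $\mathrm{Int}_N(A)$ is the set of $e\in A$ that are the smallest element of some cocircuit of $N$ contained in $(E\setminus A)\cup\{e\}$, $\iota_N(A)=|\mathrm{Int}_N(A)|$. The rank codrop is $rcd_{M,M'}(A)=r(M)-r(M')-(r_M(A)-r_{M'}(A))$. The Tutte polynomial of the perspective is $t(M,M';x,y,z)=\sum_{A\subseteq E}(x-1)^{r(M')-r_{M'}(A)}(y-1)^{|A|-r_M(A)}z^{rcd_{M,M'}(A)}$. *)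

theory Defs
  imports Main "HOL-Computational_Algebra.Polynomial"
begin

section \<open>Matroids\<close>

text \<open>A matroid on \<open>E\<close> is given by its family \<open>\<I>\<close> of independent sets.\<close>

locale matroid =
  fixes E :: "'a set" and \<I> :: "'a set set"
  assumes finite_ground: "finite E"
    and indep_subset_ground: "X \<in> \<I> \<Longrightarrow> X \<subseteq> E"
    and indep_empty: "{} \<in> \<I>"
    and indep_subset: "X \<in> \<I> \<Longrightarrow> Y \<subseteq> X \<Longrightarrow> Y \<in> \<I>"
    and indep_augment:
      "X \<in> \<I> \<Longrightarrow> Y \<in> \<I> \<Longrightarrow> card X < card Y \<Longrightarrow> \<exists>y \<in> Y - X. insert y X \<in> \<I>"

definition circuit :: "'a set \<Rightarrow> 'a set set \<Rightarrow> 'a set \<Rightarrow> bool" where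
  "circuit E \<I> C \<longleftrightarrow> C \<subseteq> E \<and> C \<notin> \<I> \<and> (\<forall>D. D \<subset> C \<longrightarrow> D \<in> \<I>)"

definition basis :: "'a set set \<Rightarrow> 'a set \<Rightarrow> bool" where
  "basis \<I> B \<longleftrightarrow> B \<in> \<I> \<and> (\<forall>X \<in> \<I>. B \<subseteq> X \<longrightarrow> X = B)"

definition dual :: "'a set \<Rightarrow> 'a set set \<Rightarrow> 'a set set" where
  "dual E \<I> = {X. \<exists>B. basis \<I> B \<and> X \<subseteq> E - B}"

definition cocircuit :: "'a set \<Rightarrow> 'a set set \<Rightarrow> 'a set \<Rightarrow> bool" where
  "cocircuit E \<I> D \<longleftrightarrow> circuit E (dual E \<I>) D"

definition rk :: "'a set set \<Rightarrow> 'a set \<Rightarrow> nat" where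
  "rk \<I> A = Max (card ` {X \<in> \<I>. X \<subseteq> A})"

text \<open>Corank and nullity; the subtractions do not truncate when \<open>A \<subseteq> E\<close>.\<close>

definition cr :: "'a set \<Rightarrow> 'a set set \<Rightarrow> 'a set \<Rightarrow> nat" where
  "cr E \<I> A = rk \<I> E - rk \<I> A"

definition nl :: "'a set set \<Rightarrow> 'a set \<Rightarrow> nat" where
  "nl \<I> A = card A - rk \<I> A"


section \<open>Activities\<close>

definition Ext :: "'a::linorder set \<Rightarrow> 'a set set \<Rightarrow> 'a set \<Rightarrow> 'a set" where
  "Ext E \<I> A =
    {e \<in> E - A. \<exists>C. circuit E \<I> C \<and> C \<subseteq> A \<union> {e} \<and> e \<in> C \<and> (\<forall>c \<in> C. e \<le> c)}"

definition ext_act :: "'a::linorder set \<Rightarrow> 'a set set \<Rightarrow> 'a set \<Rightarrow> nat" where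
  "ext_act E \<I> A = card (Ext E \<I> A)"

definition Int_act :: "'a::linorder set \<Rightarrow> 'a set set \<Rightarrow> 'a set \<Rightarrow> 'a set" where
  "Int_act E \<I> A =
    {e \<in> A. \<exists>D. cocircuit E \<I> D \<and> D \<subseteq> (E - A) \<union> {e} \<and> e \<in> D \<and> (\<forall>d \<in> D. e \<le> d)}"

definition int_act :: "'a::linorder set \<Rightarrow> 'a set set \<Rightarrow> 'a set \<Rightarrow> nat" where
  "int_act E \<I> A = card (Int_act E \<I> A)"


section \<open>Matroid perspectives and their Tutte polynomial\<close>

definition matroid_perspective :: "'a set \<Rightarrow> 'a set set \<Rightarrow> 'a set set \<Rightarrow> bool" where
  "matroid_perspective E \<I> \<I>' \<longleftrightarrow> matroid E \<I> \<and> matroid E \<I>' \<and>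
    (\<forall>C. circuit E \<I> C \<longrightarrow> (\<exists>\<D>. (\<forall>D \<in> \<D>. circuit E \<I>' D) \<and> C = \<Union>\<D>))"

definition rcd :: "'a set \<Rightarrow> 'a set set \<Rightarrow> 'a set set \<Rightarrow> 'a set \<Rightarrow> int" where
  "rcd E \<I> \<I>' A =
    int (rk \<I> E) - int (rk \<I>' E) - (int (rk \<I> A) - int (rk \<I>' A))"

text \<open>For a perspective and \<open>A \<subseteq> E\<close> the rank codrop is non-negative, so \<open>nat\<close> is only
  a type conversion.\<close>

definition tutte ::
  "'a set \<Rightarrow> 'a set set \<Rightarrow> 'a set set \<Rightarrow> 'r \<Rightarrow> 'r \<Rightarrow> 'r \<Rightarrow> 'r::comm_ring_1" where
  "tutte E \<I> \<I>' x y z =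
    (\<Sum>A | A \<subseteq> E. (x - 1) ^ (rk \<I>' E - rk \<I>' A) * (y - 1) ^ (card A - rk \<I> A)
      * z ^ nat (rcd E \<I> \<I>' A))"

text \<open>The polynomial ring in three variables over the integers is represented as
  \<open>\<int>[z][y][x]\<close>: the outermost variable is \<open>x\<close>, the innermost is \<open>z\<close>.\<close>

type_synonym poly3 = "int poly poly poly"

definition var_x :: poly3 where "var_x = [:0, 1:]"
definition var_y :: poly3 where "var_y = [:[:0, 1:]:]"
definition var_z :: poly3 where "var_z = [:[:[:0, 1:]:]:]"

definition partial_x :: "poly3 \<Rightarrow> poly3" where "partial_x = pderiv"
definition partial_y :: "poly3 \<Rightarrow> poly3" where "partial_y = map_poly pderiv"

end

theory Submission
  imports Defs
begin

text \<open>
  Decide membership in \<open>A\<close> one element at a time, from the largest element of \<open>E\<close> to the smallest.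
  When \<open>e\<close> is reached, the decisions made so far define a minor of the perspective whose largest
  element is \<open>e\<close>. The corank of \<open>A\<close> in \<open>M'\<close> counts the rejected coloops of \<open>M'\<close> and the internal
  activity the accepted ones; the nullity in \<open>M\<close> counts the accepted loops of \<open>M\<close> and the
  external activity the rejected ones; the rank codrop counts the rejected coloops of \<open>M\<close> that are
  not coloops of \<open>M'\<close>. For a loop of \<open>M\<close> or a coloop of \<open>M'\<close>, deletion and contraction give the same
  minor, so the five-variable sum of \<open>x^\<iota> u^cr y^\<epsilon> v^nl z^rcd\<close> depends on \<open>x, u, y, v\<close> only through
  \<open>x + u\<close> and \<open>y + v\<close>. Replacing \<open>(x, u, y, v)\<close> by \<open>(1, x + u - 1, 1, y + v - 1)\<close> turns it into
  \<open>t(x + u, y + v, z)\<close>; the theorem compares the coefficients of \<open>u^p v^q\<close>.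
\<close>

section \<open>Rank, closure and circuits\<close>

text \<open>Membership of \<open>e\<close> in the closure of \<open>S\<close>, expressed by rank so
  that telescoping sums of ranks count the elements that are not spanned.\<close>

definition spans :: "'a set set \<Rightarrow> 'a set \<Rightarrow> 'a \<Rightarrow> bool" where
  "spans \<I> S e \<longleftrightarrow> rk \<I> (insert e S) = rk \<I> S"

text \<open>A minimal dependent subset of \<open>insert e Y\<close> must contain \<open>e\<close>,
  because \<open>Y\<close> is independent. Only heredity of the family is assumed, so the lemma also
  applies to \<open>dual E \<I>\<close> without a proof that the dual is a matroid.\<close>

lemma circuit_through_iff:
  assumes "e \<in> E" "\<And>X. X \<in> \<I> \<Longrightarrow> X \<subseteq> E" "\<And>X Y. X \<in> \<I> \<Longrightarrow> Y \<subseteq> X \<Longrightarrow> Y \<in> \<I>" "finite E"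
  shows "(\<exists>C. circuit E \<I> C \<and> e \<in> C \<and> C \<subseteq> insert e S) \<longleftrightarrow>
    (\<exists>Y. Y \<subseteq> S \<and> Y \<in> \<I> \<and> insert e Y \<notin> \<I>)"
proof
  assume "\<exists>C. circuit E \<I> C \<and> e \<in> C \<and> C \<subseteq> insert e S"
  then obtain C where C: "circuit E \<I> C" "e \<in> C" "C \<subseteq> insert e S" by blast
  then have "C - {e} \<subseteq> S \<and> C - {e} \<in> \<I> \<and> insert e (C - {e}) \<notin> \<I>"
    by (auto simp: circuit_def insert_absorb)
  then show "\<exists>Y. Y \<subseteq> S \<and> Y \<in> \<I> \<and> insert e Y \<notin> \<I>" by blast
next
  assume "\<exists>Y. Y \<subseteq> S \<and> Y \<in> \<I> \<and> insert e Y \<notin> \<I>"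
  then obtain Y where Y: "Y \<subseteq> S" "Y \<in> \<I>" "insert e Y \<notin> \<I>" by blast
  have fin: "finite {D. D \<subseteq> insert e Y \<and> D \<notin> \<I>}"
    using assms(2)[OF Y(2)] assms(4) by (simp add: finite_subset)
  then obtain C where "C \<in> {D. D \<subseteq> insert e Y \<and> D \<notin> \<I>}"
    and min: "\<forall>D\<in>{D. D \<subseteq> insert e Y \<and> D \<notin> \<I>}. D \<subseteq> C \<longrightarrow> C = D"
    using finite_has_minimal2[OF fin, of "insert e Y"] Y(3) by auto
  then have C: "C \<subseteq> insert e Y" "C \<notin> \<I>" by simp_all
  have "D \<in> \<I>" if "D \<subset> C" for D
    using C(1) min[rule_format, of D] that by auto
  moreover have "C \<subseteq> E" using C(1) assms(1) assms(2)[OF Y(2)] by blast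
  ultimately have "circuit E \<I> C" using C(2) by (simp add: circuit_def)
  moreover have "e \<in> C" using C assms(3)[OF Y(2), of C] by (auto simp: subset_insert)
  moreover have "C \<subseteq> insert e S" using C(1) Y(1) by auto
  ultimately show "\<exists>C. circuit E \<I> C \<and> e \<in> C \<and> C \<subseteq> insert e S" by auto
qed

context matroid
begin

lemma finite_indep: "finite \<I>"
  by (rule finite_subset[of _ "Pow E"]) (auto simp: finite_ground dest: indep_subset_ground)

lemma finite_of_indep: "X \<in> \<I> \<Longrightarrow> finite X"
  by (rule finite_subset[OF indep_subset_ground finite_ground])

lemma card_le_rk: "X \<in> \<I> \<Longrightarrow> X \<subseteq> A \<Longrightarrow> card X \<le> rk \<I> A"
  unfolding rk_def using finite_indep by (intro Max_ge) auto

lemma rk_attained: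
  obtains X where "X \<in> \<I>" "X \<subseteq> A" "card X = rk \<I> A"
proof -
  have "rk \<I> A \<in> card ` {X \<in> \<I>. X \<subseteq> A}"
    unfolding rk_def using finite_indep indep_empty by (intro Max_in) auto
  then show thesis using that by auto
qed

lemma indep_extends:
  assumes "Y \<in> \<I>" "Y \<subseteq> A"
  obtains X where "X \<in> \<I>" "Y \<subseteq> X" "X \<subseteq> A" "card X = rk \<I> A"
proof -
  have fin: "finite {X \<in> \<I>. Y \<subseteq> X \<and> X \<subseteq> A}" using finite_indep by simp
  then obtain X where "X \<in> {X \<in> \<I>. Y \<subseteq> X \<and> X \<subseteq> A}"
    and max: "\<forall>Z\<in>{X \<in> \<I>. Y \<subseteq> X \<and> X \<subseteq> A}. X \<subseteq> Z \<longrightarrow> X = Z"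
    using finite_has_maximal2[OF fin, of Y] assms by auto
  then have X: "X \<in> \<I>" "Y \<subseteq> X" "X \<subseteq> A" by simp_all
  obtain Z where Z: "Z \<in> \<I>" "Z \<subseteq> A" "card Z = rk \<I> A" by (rule rk_attained)
  have "\<not> card X < card Z"
  proof
    assume "card X < card Z"
    then obtain z where "z \<in> Z - X" "insert z X \<in> \<I>" using indep_augment X(1) Z(1) by blast
    then show False using X max[rule_format, of "insert z X"] Z(2) by auto
  qed
  then have "card X = rk \<I> A" using card_le_rk[OF X(1,3)] Z(3) by simp
  then show thesis using that X by blast
qed

lemma rk_mono: "A \<subseteq> B \<Longrightarrow> rk \<I> A \<le> rk \<I> B"
  by (rule rk_attained[of A]) (metis card_le_rk subset_trans)

lemma rk_le_card: "finite A \<Longrightarrow> rk \<I> A \<le> card A"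
  by (rule rk_attained[of A]) (metis card_mono)

lemma rk_insert_le: "rk \<I> (insert e A) \<le> Suc (rk \<I> A)"
proof -
  obtain X where X: "X \<in> \<I>" "X \<subseteq> insert e A" "card X = rk \<I> (insert e A)" by (rule rk_attained)
  have "card (X - {e}) \<le> rk \<I> A"
    using X(2) by (intro card_le_rk indep_subset[OF X(1)]) auto
  moreover have "card X \<le> Suc (card (X - {e}))"
    by (auto simp: card_Diff_singleton_if)
  ultimately show ?thesis using X(3) by simp
qed

lemma rk_insert: "rk \<I> (insert e A) = rk \<I> A + of_bool (\<not> spans \<I> A e)"
  using rk_insert_le[of e A] rk_mono[OF subset_insertI[of A e]] by (auto simp: spans_def)

lemma rk_Un_le: "finite B \<Longrightarrow> rk \<I> (A \<union> B) \<le> rk \<I> A + card B"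
proof (induction B rule: finite_induct)
  case (insert b B)
  then show ?case using rk_insert_le[of b "A \<union> B"] by simp
qed simp

text \<open>If some independent \<open>Y\<close> inside \<open>S\<close> is completed to a dependent
  set by \<open>e\<close>, extend \<open>Y\<close> to a maximum independent subset of
  \<open>S\<close> and then of \<open>insert e S\<close>: the extension can never contain
  \<open>e\<close>. The right-hand side is visibly monotone in \<open>S\<close> and has the form
  that circuits give.\<close>

lemma spans_iff: "spans \<I> S e \<longleftrightarrow> (e \<in> S \<or> (\<exists>Y. Y \<subseteq> S \<and> Y \<in> \<I> \<and> insert e Y \<notin> \<I>))"
proof (cases "e \<in> S")
  case True
  then show ?thesis by (simp add: spans_def insert_absorb)
next
  case e: False
  show ?thesis
  proof
    assume s: "spans \<I> S e"
    obtain Y where Y: "Y \<in> \<I>" "Y \<subseteq> S" "card Y = rk \<I> S" by (rule rk_attained)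
    have "insert e Y \<notin> \<I>"
    proof
      assume "insert e Y \<in> \<I>"
      then have "card (insert e Y) \<le> rk \<I> (insert e S)" using Y by (intro card_le_rk) auto
      moreover have "card (insert e Y) = Suc (card Y)"
        using Y e finite_of_indep[OF Y(1)] by (intro card_insert_disjoint) auto
      ultimately show False using s Y(3) by (simp add: spans_def)
    qed
    then show "e \<in> S \<or> (\<exists>Y. Y \<subseteq> S \<and> Y \<in> \<I> \<and> insert e Y \<notin> \<I>)" using Y by blast
  next
    assume "e \<in> S \<or> (\<exists>Y. Y \<subseteq> S \<and> Y \<in> \<I> \<and> insert e Y \<notin> \<I>)"
    then obtain Y where Y: "Y \<subseteq> S" "Y \<in> \<I>" "insert e Y \<notin> \<I>" using e by blast
    obtain X where X: "X \<in> \<I>" "Y \<subseteq> X" "X \<subseteq> S" "card X = rk \<I> S"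
      by (rule indep_extends[OF Y(2,1)])
    obtain Z where Z: "Z \<in> \<I>" "X \<subseteq> Z" "Z \<subseteq> insert e S" "card Z = rk \<I> (insert e S)"
      by (rule indep_extends[OF X(1) subset_insertI2[OF X(3)]])
    have "e \<notin> Z" using Y(3) X(2) Z(2) indep_subset[OF Z(1), of "insert e Y"] by auto
    then have "card Z \<le> rk \<I> S" using Z by (intro card_le_rk) auto
    then show "spans \<I> S e" using Z(4) rk_mono[of S "insert e S"] by (simp add: spans_def subset_insertI)
  qed
qed

lemma spans_mono: "spans \<I> S e \<Longrightarrow> S \<subseteq> T \<Longrightarrow> spans \<I> T e"
  unfolding spans_iff using subset_trans[of _ S T] by auto

lemma spans_iff_circuit:
  assumes "e \<in> E" "e \<notin> S"
  shows "spans \<I> S e \<longleftrightarrow> (\<exists>C. circuit E \<I> C \<and> e \<in> C \<and> C \<subseteq> insert e S)"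
  using circuit_through_iff[OF assms(1) indep_subset_ground indep_subset finite_ground, where S = S]
  by (simp add: spans_iff assms(2))

lemma basis_iff: "basis \<I> B \<longleftrightarrow> B \<in> \<I> \<and> card B = rk \<I> E"
proof
  assume B: "basis \<I> B"
  then have BI: "B \<in> \<I>" by (simp add: basis_def)
  obtain X where "X \<in> \<I>" "B \<subseteq> X" "card X = rk \<I> E"
    by (rule indep_extends[OF BI indep_subset_ground[OF BI]])
  then show "B \<in> \<I> \<and> card B = rk \<I> E" using B by (auto simp: basis_def)
next
  assume B: "B \<in> \<I> \<and> card B = rk \<I> E"
  have "X = B" if "X \<in> \<I>" "B \<subseteq> X" for X
    using card_seteq[OF finite_of_indep[OF that(1)] that(2)] card_le_rk[OF that(1)] B
      indep_subset_ground[OF that(1)] by simp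
  then show "basis \<I> B" using B by (simp add: basis_def)
qed

section \<open>Coindependent sets and cocircuits\<close>

lemma dual_iff: "Y \<in> dual E \<I> \<longleftrightarrow> Y \<subseteq> E \<and> rk \<I> (E - Y) = rk \<I> E"
proof
  assume "Y \<in> dual E \<I>"
  then obtain B where B: "B \<in> \<I>" "card B = rk \<I> E" "Y \<subseteq> E - B" by (auto simp: dual_def basis_iff)
  have "rk \<I> E \<le> rk \<I> (E - Y)"
    using card_le_rk[OF B(1), of "E - Y"] B indep_subset_ground[OF B(1)] by auto
  then show "Y \<subseteq> E \<and> rk \<I> (E - Y) = rk \<I> E" using B(3) rk_mono[of "E - Y" E] by auto
next
  assume Y: "Y \<subseteq> E \<and> rk \<I> (E - Y) = rk \<I> E"
  obtain B where "B \<in> \<I>" "B \<subseteq> E - Y" "card B = rk \<I> (E - Y)" by (rule rk_attained)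
  then show "Y \<in> dual E \<I>" using Y by (auto simp: dual_def basis_iff)
qed

lemma cocircuit_through_iff:
  assumes e: "e \<in> E" "e \<notin> X" and X: "X \<subseteq> E"
  shows "(\<exists>D. cocircuit E \<I> D \<and> e \<in> D \<and> D \<subseteq> insert e X) \<longleftrightarrow> \<not> spans \<I> (E - insert e X) e"
proof -
  have "(\<exists>D. cocircuit E \<I> D \<and> e \<in> D \<and> D \<subseteq> insert e X) \<longleftrightarrow>
      (\<exists>Y. Y \<subseteq> X \<and> Y \<in> dual E \<I> \<and> insert e Y \<notin> dual E \<I>)"
    unfolding cocircuit_def using e(1) finite_ground
    by (intro circuit_through_iff) (auto simp: dual_def)
  also have "\<dots> \<longleftrightarrow> \<not> spans \<I> (E - insert e X) e"
  proof
    assume "\<exists>Y. Y \<subseteq> X \<and> Y \<in> dual E \<I> \<and> insert e Y \<notin> dual E \<I>"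
    then obtain Y where Y: "Y \<subseteq> X" "Y \<in> dual E \<I>" "insert e Y \<notin> dual E \<I>" by blast
    have "insert e (E - insert e Y) = E - Y" using e Y by blast
    then have "\<not> spans \<I> (E - insert e Y) e"
      using Y(2,3) e(1) by (auto simp: dual_iff spans_def)
    moreover have "E - insert e X \<subseteq> E - insert e Y" using Y(1) by blast
    ultimately show "\<not> spans \<I> (E - insert e X) e" using spans_mono by blast
  next
    assume n: "\<not> spans \<I> (E - insert e X) e"
    have ins: "insert e (E - insert e X) = E - X" using e by blast
    \<comment> \<open>\<open>B\<close> extends a basis of \<open>E - X\<close>, so \<open>B0\<close>
      and \<open>B \<inter> X\<close> are disjoint parts of \<open>B\<close>. The witness is
      \<open>X - B\<close>: its complement contains \<open>B\<close>, but loses rank when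
      \<open>e\<close> is removed as well, since \<open>e\<close> contributes to the rank of
      \<open>E - X\<close>.\<close>
    obtain B0 where B0: "B0 \<in> \<I>" "B0 \<subseteq> E - X" "card B0 = rk \<I> (E - X)" by (rule rk_attained)
    obtain B where B: "B \<in> \<I>" "B0 \<subseteq> B" "card B = rk \<I> E"
      by (rule indep_extends[OF B0(1) indep_subset_ground[OF B0(1)]])
    have fB: "finite B" by (rule finite_of_indep[OF B(1)])
    have Y: "X - B \<in> dual E \<I>"
      using B indep_subset_ground[OF B(1)] X by (auto simp: dual_def basis_iff)
    have "E - insert e (X - B) \<subseteq> (E - insert e X) \<union> (B \<inter> X)" by blast
    then have "rk \<I> (E - insert e (X - B)) \<le> rk \<I> ((E - insert e X) \<union> (B \<inter> X))"
      by (rule rk_mono)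
    also have "\<dots> \<le> rk \<I> (E - insert e X) + card (B \<inter> X)" using fB by (intro rk_Un_le) simp
    also have "\<dots> < card B0 + card (B \<inter> X)"
      using rk_insert[of e "E - insert e X"] n ins B0(3) by simp
    also have "\<dots> = card (B0 \<union> (B \<inter> X))"
      using fB B0(2) finite_of_indep[OF B0(1)] by (subst card_Un_disjoint) auto
    also have "\<dots> \<le> card B" using fB B(2) by (intro card_mono) auto
    finally have "insert e (X - B) \<notin> dual E \<I>" using B(3) by (simp add: dual_iff)
    then show "\<exists>Y. Y \<subseteq> X \<and> Y \<in> dual E \<I> \<and> insert e Y \<notin> dual E \<I>" using Y by blast
  qed
  finally show ?thesis .
qed

text \<open>In the minor with accepted set \<open>S\<close> and undecided set \<open>L\<close>,
  \<open>e\<close> is a loop or a coloop, so its deletion and contraction agree. The rank step of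
  \<open>e\<close> is the same over \<open>Y\<close> and over \<open>insert f Y\<close>; adding
  \<open>e\<close> and \<open>f\<close> in either order then gives the same rank step for
  \<open>f\<close>.\<close>

lemma spans_insert_cong:
  assumes e: "spans \<I> S e \<or> \<not> spans \<I> (S \<union> L) e"
    and Y: "S \<subseteq> Y" "insert f Y \<subseteq> S \<union> L"
  shows "spans \<I> (insert e Y) f \<longleftrightarrow> spans \<I> Y f"
proof -
  have "spans \<I> (insert f Y) e = spans \<I> Y e"
  proof (cases "spans \<I> S e")
    case True
    then have "spans \<I> Y e" by (rule spans_mono) (rule Y)
    moreover from this have "spans \<I> (insert f Y) e" by (rule spans_mono) (rule subset_insertI)
    ultimately show ?thesis by simp
  next
    case False
    then have *: "\<not> spans \<I> (S \<union> L) e" using e by simp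
    have "\<not> spans \<I> (insert f Y) e" using * spans_mono[OF _ Y(2)] by blast
    moreover have "\<not> spans \<I> Y e"
      using calculation spans_mono[OF _ subset_insertI] by blast
    ultimately show ?thesis by simp
  qed
  then have "rk \<I> (insert f (insert e Y)) = rk \<I> (insert f Y) + of_bool (\<not> spans \<I> Y e)"
    using rk_insert[of e "insert f Y"] by (simp add: insert_commute[of f e])
  then show ?thesis
    unfolding spans_def[of \<I> "insert e Y" f] spans_def[of \<I> Y f] rk_insert[of e Y] by simp
qed

end

section \<open>Activities and ranks along the order\<close>

text \<open>If \<open>e\<close> is the smallest element of a circuit, the rest of the circuit lies
  in the part of \<open>A\<close> above \<open>e\<close>.\<close>

lemma Ext_eq:
  assumes "matroid E \<I>"
  shows "Ext E \<I> A = {e \<in> E - A. spans \<I> {a \<in> A. e < a} e}"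
proof -
  have "C \<subseteq> A \<union> {e} \<and> e \<in> C \<and> (\<forall>c\<in>C. e \<le> c) \<longleftrightarrow> e \<in> C \<and> C \<subseteq> insert e {a \<in> A. e < a}"
    for C e by fastforce
  then show ?thesis
    unfolding Ext_def using matroid.spans_iff_circuit[OF assms] by auto
qed

text \<open>Dually, the cocircuit minus \<open>e\<close> consists of rejected elements above
  \<open>e\<close>. The complement of all these candidates and \<open>e\<close> is what was accepted
  above \<open>e\<close> together with everything below \<open>e\<close>.\<close>

lemma Int_act_eq:
  assumes "matroid E \<I>" and A: "A \<subseteq> E"
  shows "Int_act E \<I> A = {e \<in> A. \<not> spans \<I> ({a \<in> A. e < a} \<union> {a \<in> E. a < e}) e}"
proof -
  have "(\<exists>D. cocircuit E \<I> D \<and> D \<subseteq> (E - A) \<union> {e} \<and> e \<in> D \<and> (\<forall>d\<in>D. e \<le> d)) \<longleftrightarrow>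
      \<not> spans \<I> ({a \<in> A. e < a} \<union> {a \<in> E. a < e}) e" if "e \<in> A" for e
  proof -
    have "D \<subseteq> (E - A) \<union> {e} \<and> e \<in> D \<and> (\<forall>d\<in>D. e \<le> d) \<longleftrightarrow>
        e \<in> D \<and> D \<subseteq> insert e {a \<in> E - A. e < a}" for D
      by fastforce
    moreover have "E - insert e {a \<in> E - A. e < a} = {a \<in> A. e < a} \<union> {a \<in> E. a < e}"
      using A that by auto
    ultimately show ?thesis
      using matroid.cocircuit_through_iff[OF assms(1), of e "{a \<in> E - A. e < a}"] that A by auto
  qed
  then show ?thesis unfolding Int_act_def by auto
qed

lemma sum_telescope_upper:
  fixes g :: "'a::linorder set \<Rightarrow> int"
  assumes "finite A"
  shows "(\<Sum>e\<in>A. g {a \<in> A. e \<le> a} - g {a \<in> A. e < a}) = g A - g {}"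
  using assms
proof (induction A rule: finite_linorder_min_induct)
  case (insert b A)
  have eq: "{a \<in> insert b A. e \<le> a} = {a \<in> A. e \<le> a}" "{a \<in> insert b A. e < a} = {a \<in> A. e < a}"
    if "e \<in> A" for e using insert(2) that by auto
  have "{a \<in> insert b A. b \<le> a} = insert b A" "{a \<in> insert b A. b < a} = A" "b \<notin> A"
    using insert(2) by auto
  then show ?case using insert eq by simp
qed simp

text \<open>As \<open>e\<close> runs downwards through \<open>E\<close>, the sets shrink from
  \<open>E\<close> to \<open>A\<close>, one rejected element at a time; the subtracted set at
  \<open>e\<close> is the first set at the predecessor of \<open>e\<close>.\<close>

lemma sum_telescope_exchange:
  fixes g :: "'a::linorder set \<Rightarrow> int"
  assumes "finite E" "A \<subseteq> E"
  shows "(\<Sum>e\<in>E. g ({a \<in> A. e < a} \<union> {a \<in> E. a \<le> e}) - g ({a \<in> A. e \<le> a} \<union> {a \<in> E. a < e}))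
    = g E - g A"
  using assms
proof (induction E arbitrary: A g rule: finite_linorder_max_induct)
  case (insert b E)
  define A' where "A' = A - {b}"
  have b: "b \<notin> E" using insert(2) by blast
  have eq: "{a \<in> A. e < a} \<union> {a \<in> insert b E. a \<le> e} = {a \<in> A'. e < a} \<union> {a \<in> E. a \<le> e} \<union> (A \<inter> {b})"
    "{a \<in> A. e \<le> a} \<union> {a \<in> insert b E. a < e} = {a \<in> A'. e \<le> a} \<union> {a \<in> E. a < e} \<union> (A \<inter> {b})"
    if "e \<in> E" for e using insert(2) that by (auto simp: A'_def)
  have "{a \<in> A. b < a} \<union> {a \<in> insert b E. a \<le> b} = insert b E"
    "{a \<in> A. b \<le> a} \<union> {a \<in> insert b E. a < b} = E \<union> (A \<inter> {b})"
    using insert(2,4) by force+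
  moreover have "A' \<subseteq> E" "A' \<union> (A \<inter> {b}) = A" using insert(4) by (auto simp: A'_def)
  ultimately show ?case
    \<comment> \<open>If the largest element \<open>b\<close> lies in \<open>A\<close>, it stays in
      every set of the chain; the function in the induction hypothesis absorbs it.\<close>
    using insert(3)[of A' "\<lambda>X. g (X \<union> (A \<inter> {b}))"] insert(1) b eq by simp
qed simp

text \<open>Building \<open>A\<close> from its largest element downwards, each element raises the
  rank by one unless it is already spanned.\<close>

lemma nl_eq_card:
  fixes E :: "'a::linorder set"
  assumes "matroid E \<I>" "A \<subseteq> E"
  shows "nl \<I> A = card {e \<in> A. spans \<I> {a \<in> A. e < a} e}"
proof -
  interpret matroid E \<I> by fact
  have fin: "finite A" using assms(2) finite_ground finite_subset by blast
  have "int (rk \<I> {a \<in> A. e \<le> a}) - int (rk \<I> {a \<in> A. e < a}) = 1 - of_bool (spans \<I> {a \<in> A. e < a} e)"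
    if "e \<in> A" for e
  proof -
    have "{a \<in> A. e \<le> a} = insert e {a \<in> A. e < a}" using that by auto
    then show ?thesis using rk_insert[of e "{a \<in> A. e < a}"] by simp
  qed
  then have "(\<Sum>e\<in>A. 1 - of_bool (spans \<I> {a \<in> A. e < a} e)) = int (rk \<I> A) - int (rk \<I> {})"
    using sum_telescope_upper[OF fin, of "\<lambda>X. int (rk \<I> X)"] by simp
  then have "int (card A) - int (card {e \<in> A. spans \<I> {a \<in> A. e < a} e}) = int (rk \<I> A)"
    using fin rk_le_card[of "{}"] by (simp add: sum_subtractf Int_def)
  then show ?thesis by (simp add: nl_def)
qed

text \<open>Along the chain from \<open>E\<close> down to \<open>A\<close>, an accepted element
  changes nothing, and removing a rejected one lowers the rank exactly when the remaining set does
  not span it.\<close>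

lemma cr_eq_card:
  fixes E :: "'a::linorder set"
  assumes "matroid E \<I>" "A \<subseteq> E"
  shows "cr E \<I> A = card {e \<in> E - A. \<not> spans \<I> ({a \<in> A. e < a} \<union> {a \<in> E. a < e}) e}"
proof -
  interpret matroid E \<I> by fact
  let ?T = "\<lambda>e. {a \<in> A. e < a} \<union> {a \<in> E. a < e}"
  have "int (rk \<I> ({a \<in> A. e < a} \<union> {a \<in> E. a \<le> e})) - int (rk \<I> ({a \<in> A. e \<le> a} \<union> {a \<in> E. a < e}))
      = of_bool (e \<notin> A \<and> \<not> spans \<I> (?T e) e)" if "e \<in> E" for e
  proof (cases "e \<in> A")
    case True
    then have "{a \<in> A. e < a} \<union> {a \<in> E. a \<le> e} = {a \<in> A. e \<le> a} \<union> {a \<in> E. a < e}"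
      using assms(2) by auto
    then show ?thesis using True by simp
  next
    case False
    then have "{a \<in> A. e < a} \<union> {a \<in> E. a \<le> e} = insert e (?T e)"
      "{a \<in> A. e \<le> a} \<union> {a \<in> E. a < e} = ?T e"
      using assms(2) that by (auto simp: order.order_iff_strict)
    then show ?thesis using rk_insert[of e "?T e"] False by simp
  qed
  then have "(\<Sum>e\<in>E. of_bool (e \<notin> A \<and> \<not> spans \<I> (?T e) e)) = int (rk \<I> E) - int (rk \<I> A)"
    using sum_telescope_exchange[OF finite_ground assms(2), of "\<lambda>X. int (rk \<I> X)"] by simp
  moreover have "E \<inter> {e. e \<notin> A \<and> \<not> spans \<I> (?T e) e} = {e \<in> E - A. \<not> spans \<I> (?T e) e}" by blast
  ultimately show ?thesis using finite_ground by (simp add: cr_def)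
qed

text \<open>A circuit of \<open>\<I>\<close> through \<open>e\<close> is a union of circuits of
  \<open>\<I>'\<close>, one of which contains \<open>e\<close>. Hence in each minor loops of
  \<open>\<I>\<close> are loops of \<open>\<I>'\<close>, and coloops of \<open>\<I>'\<close> are
  coloops of \<open>\<I>\<close>.\<close>

lemma spans_perspective:
  assumes "matroid_perspective E \<I> \<I>'" "e \<in> E" "spans \<I> S e"
  shows "spans \<I>' S e"
proof (cases "e \<in> S")
  case True
  then show ?thesis by (simp add: spans_def insert_absorb)
next
  case False
  interpret M: matroid E \<I> using assms(1) by (simp add: matroid_perspective_def)
  interpret M': matroid E \<I>' using assms(1) by (simp add: matroid_perspective_def)
  obtain C where C: "circuit E \<I> C" "e \<in> C" "C \<subseteq> insert e S"
    using M.spans_iff_circuit[OF assms(2) False] assms(3) by blast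
  then obtain D where "circuit E \<I>' D" "e \<in> D" "D \<subseteq> C"
    using assms(1) unfolding matroid_perspective_def by (metis Union_iff Union_upper)
  then show ?thesis using M'.spans_iff_circuit[OF assms(2) False] C(3) by blast
qed

section \<open>Sums over sequences of decisions\<close>

text \<open>\<open>S\<close> is the set of elements accepted before the elements of \<open>L\<close> are considered;
  \<open>w e T c\<close> is the weight of accepting (\<open>c\<close>) or rejecting \<open>e\<close> after accepting \<open>T\<close>.\<close>

definition decision_sum ::
  "('a::linorder \<Rightarrow> 'a set \<Rightarrow> bool \<Rightarrow> 'r::comm_ring_1) \<Rightarrow> 'a set \<Rightarrow> 'a set \<Rightarrow> 'r" where
  "decision_sum w L S = (\<Sum>A | A \<subseteq> L. \<Prod>e\<in>L. w e (S \<union> {a \<in> A. e < a}) (e \<in> A))"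

text \<open>The largest element is decided first. Since \<open>b\<close> lies above all of
  \<open>L\<close>, accepting it adds \<open>b\<close> to the accepted set seen by every later
  decision.\<close>

lemma decision_sum_insert:
  assumes "finite L" and L: "\<forall>a\<in>L. a < b"
  shows "decision_sum w (insert b L) S =
    w b S False * decision_sum w L S + w b S True * decision_sum w L (insert b S)"
proof -
  let ?f = "\<lambda>A. \<Prod>e\<in>insert b L. w e (S \<union> {a \<in> A. e < a}) (e \<in> A)"
  have b: "b \<notin> L" using L by blast
  have "{A. A \<subseteq> insert b L} = Pow L \<union> insert b ` Pow L" using Pow_insert[of b L] by (simp add: Pow_def)
  moreover have "Pow L \<inter> insert b ` Pow L = {}" using b by blast
  moreover have inj: "inj_on (insert b) (Pow L)" using b by (auto simp: inj_on_def)
  ultimately have "decision_sum w (insert b L) S =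
      (\<Sum>A\<in>Pow L. ?f A) + (\<Sum>A\<in>Pow L. ?f (insert b A))"
    using assms(1) by (simp only: decision_sum_def) (simp add: sum.union_disjoint sum.reindex)
  also have "(\<Sum>A\<in>Pow L. ?f A) = w b S False * decision_sum w L S"
    unfolding decision_sum_def sum_distrib_left
  proof (intro sum.cong)
    fix A assume "A \<in> {A. A \<subseteq> L}"
    then have e: "{a \<in> A. b < a} = {}" and "b \<notin> A" using L b by force+
    then show "?f A = w b S False * (\<Prod>e\<in>L. w e (S \<union> {a \<in> A. e < a}) (e \<in> A))"
      unfolding prod.insert[OF assms(1) b] e by simp
  qed auto
  also have "(\<Sum>A\<in>Pow L. ?f (insert b A)) = w b S True * decision_sum w L (insert b S)"
    unfolding decision_sum_def sum_distrib_left
  proof (intro sum.cong)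
    fix A assume A: "A \<in> {A. A \<subseteq> L}"
    then have e: "{a \<in> insert b A. b < a} = {}" using L by force
    have "w e (S \<union> {a \<in> insert b A. e < a}) (e \<in> insert b A) =
        w e (insert b S \<union> {a \<in> A. e < a}) (e \<in> A)" if "e \<in> L" for e
    proof -
      have "S \<union> {a \<in> insert b A. e < a} = insert b S \<union> {a \<in> A. e < a}" using L that by auto
      moreover have "e \<in> insert b A \<longleftrightarrow> e \<in> A" using b that by auto
      ultimately show ?thesis by simp
    qed
    then show "?f (insert b A) = w b S True * (\<Prod>e\<in>L. w e (insert b S \<union> {a \<in> A. e < a}) (e \<in> A))"
      unfolding prod.insert[OF assms(1) b] e by (simp cong: prod.cong)
  qed auto
  finally show ?thesis .
qed

lemma decision_sum_cong:
  assumes "\<And>e X c. e \<in> L \<Longrightarrow> X \<subseteq> L \<Longrightarrow> w e (S \<union> X) c = w' e (S' \<union> X) c"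
  shows "decision_sum w L S = decision_sum w' L S'"
  unfolding decision_sum_def by (intro sum.cong prod.cong refl assms) auto

text \<open>In the minor reached with accepted set \<open>S\<close>, the element \<open>e\<close> is a loop iff \<open>S\<close> spans it, and a
  coloop iff \<open>S\<close> together with the still undecided smaller elements does not.\<close>

definition weight ::
  "'a::linorder set \<Rightarrow> 'a set set \<Rightarrow> 'a set set \<Rightarrow> 'r \<Rightarrow> 'r \<Rightarrow> 'r \<Rightarrow> 'r \<Rightarrow> 'r \<Rightarrow>
    'a \<Rightarrow> 'a set \<Rightarrow> bool \<Rightarrow> 'r::comm_ring_1" where
  "weight E \<I> \<I>' x u y v z e S c =
    (if \<not> spans \<I>' (S \<union> {a \<in> E. a < e}) e then if c then x else u
     else if spans \<I> S e then if c then v else y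
     else if \<not> c \<and> \<not> spans \<I> (S \<union> {a \<in> E. a < e}) e then z else 1)"

lemma decision_sum_weight_eq:
  assumes P: "matroid_perspective E \<I> \<I>'"
    and "x + u = x' + u'" "y + v = y' + v'"
    and "finite L" "L \<subseteq> E" "\<And>a b. b \<in> L \<Longrightarrow> a \<in> E \<Longrightarrow> a < b \<Longrightarrow> a \<in> L"
  shows "decision_sum (weight E \<I> \<I>' x u y v z) L S = decision_sum (weight E \<I> \<I>' x' u' y' v' z) L S"
  using assms(4-)
proof (induction L arbitrary: S rule: finite_linorder_max_induct)
  case empty
  then show ?case by (simp add: decision_sum_def)
next
  case (insert b L)
  interpret M: matroid E \<I> using P by (simp add: matroid_perspective_def)
  interpret M': matroid E \<I>' using P by (simp add: matroid_perspective_def)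
  let ?w = "weight E \<I> \<I>' x u y v z" and ?w' = "weight E \<I> \<I>' x' u' y' v' z"
  have b: "b \<in> E" using insert.prems(1) by simp
  \<comment> \<open>As \<open>insert b L\<close> is an initial segment of \<open>E\<close>, the
    smaller elements that \<open>weight\<close> consults at \<open>b\<close> are exactly the
    undecided ones.\<close>
  have L: "{a \<in> E. a < b} = L" using insert.hyps(2) insert.prems by auto
  have "a \<in> L" if "c \<in> L" "a \<in> E" "a < c" for a c
    using insert.prems(2)[of c a] insert.hyps(2) that by auto
  then have IH: "decision_sum ?w L S = decision_sum ?w' L S" for S
    using insert.IH insert.prems(1) by blast
  note rec = decision_sum_insert[OF insert.hyps(1,2)]
  show ?case
  \<comment> \<open>If \<open>b\<close> is a loop of \<open>\<I>\<close> or a coloop of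
    \<open>\<I>'\<close>, both branches have the same continuation, so only the sum of the two
    weights matters, which is \<open>x + u\<close> or \<open>y + v\<close>. Otherwise the weights of
    \<open>b\<close> are \<open>1\<close> or \<open>z\<close>.\<close>
  proof (cases "spans \<I> S b \<or> \<not> spans \<I>' (S \<union> L) b")
    case True
    \<comment> \<open>By the perspective property, \<open>b\<close> is a loop or a coloop in both
      matroids at once, possibly of different kinds.\<close>
    have e: "spans \<I> S b \<or> \<not> spans \<I> (S \<union> L) b" "spans \<I>' S b \<or> \<not> spans \<I>' (S \<union> L) b"
      using True spans_perspective[OF P b] by blast+
    have "?w f (insert b S \<union> X) c = ?w f (S \<union> X) c" if f: "f \<in> L" and X: "X \<subseteq> L" for f X c
    proof -
      have low: "{a \<in> E. a < f} \<subseteq> L" using f L by auto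
      have "spans \<I> (insert b (S \<union> X)) f = spans \<I> (S \<union> X) f"
        using f X by (intro M.spans_insert_cong[OF e(1)]) auto
      moreover have "spans \<J> (insert b (S \<union> X \<union> {a \<in> E. a < f})) f =
          spans \<J> (S \<union> X \<union> {a \<in> E. a < f}) f" if "\<J> = \<I> \<or> \<J> = \<I>'" for \<J>
      proof -
        have "S \<subseteq> S \<union> X \<union> {a \<in> E. a < f}" "insert f (S \<union> X \<union> {a \<in> E. a < f}) \<subseteq> S \<union> L"
          using f X low by auto
        then show ?thesis
          using that M.spans_insert_cong[OF e(1)] M'.spans_insert_cong[OF e(2)] by blast
      qed
      ultimately show ?thesis by (simp add: weight_def)
    qed
    then have "decision_sum ?w L (insert b S) = decision_sum ?w L S"
      by (intro decision_sum_cong)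
    then have "decision_sum ?w (insert b L) S = (?w b S False + ?w b S True) * decision_sum ?w L S"
      "decision_sum ?w' (insert b L) S = (?w' b S False + ?w' b S True) * decision_sum ?w L S"
      using rec[of ?w S] rec[of ?w' S] IH by (simp_all add: distrib_right)
    moreover have "?w b S False + ?w b S True = ?w' b S False + ?w' b S True"
      using True assms(2,3) by (simp add: weight_def L add.commute)
    ultimately show ?thesis by simp
  next
    case False
    then have "?w b S c = ?w' b S c" for c by (simp add: weight_def L)
    then show ?thesis using rec[of ?w S] rec[of ?w' S] IH by simp
  qed
qed

section \<open>The activity sum and its link to the Tutte polynomial\<close>

lemma prod_if_one_eq_power:
  "finite E \<Longrightarrow> (\<Prod>e\<in>E. if Q e then c else 1) = (c::'r::comm_ring_1) ^ card {e \<in> E. Q e}"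
  by (simp add: prod.If_cases Int_def)

lemma prod_weight:
  assumes P: "matroid_perspective E \<I> \<I>'" and A: "A \<subseteq> E"
  shows "(\<Prod>e\<in>E. weight E \<I> \<I>' x u y v z e {a \<in> A. e < a} (e \<in> A)) =
    x ^ int_act E \<I>' A * u ^ cr E \<I>' A * y ^ ext_act E \<I> A * v ^ nl \<I> A * z ^ nat (rcd E \<I> \<I>' A)"
proof -
  have M: "matroid E \<I>" and M': "matroid E \<I>'" using P by (simp_all add: matroid_perspective_def)
  have fin: "finite E" using M by (rule matroid.finite_ground)
  define loop where "loop e = spans \<I> {a \<in> A. e < a} e" for e
  define coloop where "coloop e \<longleftrightarrow> \<not> spans \<I> ({a \<in> A. e < a} \<union> {a \<in> E. a < e}) e" for e
  define coloop' where "coloop' e \<longleftrightarrow> \<not> spans \<I>' ({a \<in> A. e < a} \<union> {a \<in> E. a < e}) e" for e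
  have 1: "coloop' e \<Longrightarrow> coloop e" if "e \<in> E" for e
    using spans_perspective[OF P that] by (auto simp: coloop_def coloop'_def)
  have 2: "loop e \<Longrightarrow> \<not> coloop e" for e
    using matroid.spans_mono[OF M] by (auto simp: coloop_def loop_def)
  have A_eq: "{e \<in> E. e \<in> A \<and> Q e} = {e \<in> A. Q e}" "{e \<in> E. e \<notin> A \<and> Q e} = {e \<in> E - A. Q e}" for Q
    using A by auto
  have cr_int: "int (cr E \<J> A) = int (rk \<J> E) - int (rk \<J> A)" if "matroid E \<J>" for \<J>
    using matroid.rk_mono[OF that A] by (simp add: cr_def)
  have "{e \<in> E - A. coloop e} = {e \<in> E - A. coloop' e} \<union> {e \<in> E - A. coloop e \<and> \<not> coloop' e}"
    using 1 by auto
  then have "card {e \<in> E - A. coloop e} = card {e \<in> E - A. coloop' e} + card {e \<in> E - A. coloop e \<and> \<not> coloop' e}"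
    using fin by (subst card_Un_disjoint[symmetric]) auto
  \<comment> \<open>The rank codrop is the difference of the coranks of \<open>A\<close> in
    \<open>\<I>\<close> and \<open>\<I>'\<close>, and the rejected coloops of \<open>\<I>'\<close>
    are among those of \<open>\<I>\<close>.\<close>
  then have rcd: "nat (rcd E \<I> \<I>' A) = card {e \<in> E - A. coloop e \<and> \<not> coloop' e}"
    using cr_int[OF M] cr_int[OF M'] cr_eq_card[OF M A] cr_eq_card[OF M' A]
    by (simp add: rcd_def coloop_def coloop'_def)
  \<comment> \<open>The nested cases split into five independent factors because
    \<open>coloop'\<close> implies \<open>coloop\<close>, which excludes
    \<open>loop\<close>.\<close>
  have "weight E \<I> \<I>' x u y v z e {a \<in> A. e < a} (e \<in> A) =
      (if e \<in> A \<and> coloop' e then x else 1) * (if e \<notin> A \<and> coloop' e then u else 1) *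
      (if e \<notin> A \<and> loop e then y else 1) * (if e \<in> A \<and> loop e then v else 1) *
      (if e \<notin> A \<and> coloop e \<and> \<not> coloop' e then z else 1)" if "e \<in> E" for e
  proof -
    have "weight E \<I> \<I>' x u y v z e {a \<in> A. e < a} (e \<in> A) =
        (if coloop' e then if e \<in> A then x else u else if loop e then if e \<in> A then v else y
         else if e \<notin> A \<and> coloop e then z else 1)"
      unfolding weight_def loop_def coloop_def coloop'_def by (rule refl)
    then show ?thesis
      using 1[OF that] 2[of e] by (cases "e \<in> A"; cases "coloop' e"; cases "loop e"; simp)
  qed
  then have "(\<Prod>e\<in>E. weight E \<I> \<I>' x u y v z e {a \<in> A. e < a} (e \<in> A)) =
      x ^ card {e \<in> A. coloop' e} * u ^ card {e \<in> E - A. coloop' e} *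
      y ^ card {e \<in> E - A. loop e} * v ^ card {e \<in> A. loop e} *
      z ^ card {e \<in> E - A. coloop e \<and> \<not> coloop' e}"
    by (simp only: prod.distrib prod_if_one_eq_power[OF fin] A_eq cong: prod.cong)
  then show ?thesis
    using rcd cr_eq_card[OF M' A] nl_eq_card[OF M A]
    by (simp add: int_act_def Int_act_eq[OF M' A] ext_act_def Ext_eq[OF M] loop_def coloop'_def)
qed

definition activity_sum ::
  "'a::linorder set \<Rightarrow> 'a set set \<Rightarrow> 'a set set \<Rightarrow> 'r \<Rightarrow> 'r \<Rightarrow> 'r \<Rightarrow> 'r \<Rightarrow> 'r \<Rightarrow> 'r::comm_ring_1" where
  "activity_sum E \<I> \<I>' x u y v z = (\<Sum>A | A \<subseteq> E.
    x ^ int_act E \<I>' A * u ^ cr E \<I>' A * y ^ ext_act E \<I> A * v ^ nl \<I> A * z ^ nat (rcd E \<I> \<I>' A))"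

lemma activity_sum_eq:
  assumes P: "matroid_perspective E \<I> \<I>'" and "x + u = x' + u'" "y + v = y' + v'"
  shows "activity_sum E \<I> \<I>' x u y v z = activity_sum E \<I> \<I>' x' u' y' v' z"
proof -
  have "finite E" using P by (simp add: matroid_perspective_def matroid_def)
  have "activity_sum E \<I> \<I>' x u y v z = decision_sum (weight E \<I> \<I>' x u y v z) E {}"
    for x u y v z :: 'b
    by (simp add: activity_sum_def decision_sum_def prod_weight[OF P])
  then show ?thesis using decision_sum_weight_eq[OF assms \<open>finite E\<close>] by simp
qed

corollary tutte_shift:
  assumes "matroid_perspective E \<I> \<I>'"
  shows "tutte E \<I> \<I>' (x + u) (y + v) z = activity_sum E \<I> \<I>' x u y v z"
proof -
  have "activity_sum E \<I> \<I>' x u y v z = activity_sum E \<I> \<I>' 1 (x + u - 1) 1 (y + v - 1) z"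
    by (rule activity_sum_eq[OF assms]) simp_all
  then show ?thesis by (simp add: tutte_def activity_sum_def cr_def nl_def)
qed

section \<open>Taylor coefficients and derivatives\<close>

lemma linear_power_eq_monom: "[:0, 1:] ^ n = monom (1::'r::comm_ring_1) n"
  by (simp add: monom_altdef)

text \<open>The outer indeterminate plays the role of \<open>u\<close> and the inner one that of
  \<open>v\<close>; \<open>a\<close>, \<open>b\<close>, \<open>c\<close> are constants.\<close>

lemma coeff_coeff_monomial:
  fixes a b c :: "'r::comm_ring_1"
  shows "coeff (coeff ([:[:a:]:] ^ i * [:0, 1:] ^ k * [:[:b:]:] ^ j * [:[:0, 1:]:] ^ l * [:[:c:]:] ^ m) p) q
    = (if k = p \<and> l = q then a ^ i * b ^ j * c ^ m else 0)"
  unfolding poly_const_pow linear_power_eq_monom by (simp add: mult_ac)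

lemma coeff_linear_power:
  "coeff ([:a, 1:] ^ n) i = of_nat (n choose i) * (a::'r::comm_ring_1) ^ (n - i)"
proof (cases "i \<le> n")
  case True
  then show ?thesis by (simp add: coeff_linear_poly_power)
next
  case False
  have "degree ([:a, 1:] ^ n) \<le> n" using degree_power_le[of "[:a, 1:]" n] by simp
  then show ?thesis using False by (simp add: coeff_eq_0 binomial_eq_0)
qed

lemma coeff_coeff_shifted_monomial:
  fixes a b c :: "'r::comm_ring_1"
  shows "coeff (coeff (([:[:a:]:] + [:0, 1:] - 1) ^ k * ([:[:b:]:] + [:[:0, 1:]:] - 1) ^ l * [:[:c:]:] ^ m) p) q
    = of_nat (k choose p) * (a - 1) ^ (k - p) * (of_nat (l choose q) * (b - 1) ^ (l - q)) * c ^ m"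
proof -
  have 1: "[:[:a:]:] + [:0, 1:] - 1 = [:[:a - 1:], 1:]" "[:[:b:]:] + [:[:0, 1:]:] - 1 = [:[:b - 1, 1:]:]"
    by (simp_all add: one_pCons)
  have "coeff (([:[:a:]:] + [:0, 1:] - 1) ^ k * ([:[:b:]:] + [:[:0, 1:]:] - 1) ^ l * [:[:c:]:] ^ m) p
      = [:of_nat (k choose p) * (a - 1) ^ (k - p):] * [:b - 1, 1:] ^ l * [:c ^ m:]"
    unfolding 1 poly_const_pow by (simp add: coeff_linear_power of_nat_poly poly_const_pow mult_ac)
  then show ?thesis by (simp add: coeff_linear_power mult_ac)
qed

text \<open>Both sides are the coefficient of \<open>u^p v^q\<close> in \<open>tutte_shift\<close>,
  taken over polynomials in \<open>u\<close> and \<open>v\<close>. The left side is the derivative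
  already divided by the factorials, so the identity holds over every commutative ring.\<close>

lemma tutte_Taylor_coefficient:
  fixes x y z :: "'r::comm_ring_1"
  assumes P: "matroid_perspective E \<I> \<I>'"
  shows "(\<Sum>A | A \<subseteq> E. of_nat (cr E \<I>' A choose p) * (x - 1) ^ (cr E \<I>' A - p) *
      (of_nat (nl \<I> A choose q) * (y - 1) ^ (nl \<I> A - q)) * z ^ nat (rcd E \<I> \<I>' A)) =
    (\<Sum>A | A \<subseteq> E \<and> cr E \<I>' A = p \<and> nl \<I> A = q.
      x ^ int_act E \<I>' A * y ^ ext_act E \<I> A * z ^ nat (rcd E \<I> \<I>' A))"
proof -
  have "finite E" using P by (simp add: matroid_perspective_def matroid_def)
  then have fin: "finite {A. A \<subseteq> E}" by simp
  have "coeff (coeff (tutte E \<I> \<I>' ([:[:x:]:] + [:0, 1:]) ([:[:y:]:] + [:[:0, 1:]:]) [:[:z:]:]) p) q =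
      coeff (coeff (activity_sum E \<I> \<I>' [:[:x:]:] [:0, 1:] [:[:y:]:] [:[:0, 1:]:] [:[:z:]:]) p) q"
    by (simp only: tutte_shift[OF P])
  also have "\<dots> = (\<Sum>A | A \<subseteq> E. if cr E \<I>' A = p \<and> nl \<I> A = q
      then x ^ int_act E \<I>' A * y ^ ext_act E \<I> A * z ^ nat (rcd E \<I> \<I>' A) else 0)"
    by (simp only: activity_sum_def coeff_sum coeff_coeff_monomial)
  also have "\<dots> = (\<Sum>A | A \<subseteq> E \<and> cr E \<I>' A = p \<and> nl \<I> A = q.
      x ^ int_act E \<I>' A * y ^ ext_act E \<I> A * z ^ nat (rcd E \<I> \<I>' A))"
    using sum.inter_filter[OF fin, symmetric, of "\<lambda>A. cr E \<I>' A = p \<and> nl \<I> A = q"] by simp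
  finally show ?thesis
    by (simp only: tutte_def coeff_sum coeff_coeff_shifted_monomial cr_def nl_def)
qed

section \<open>Iterated partial derivatives\<close>

text \<open>The power rule for an abstract derivation with constants \<open>g i\<close> and
  \<open>D f = 1\<close>, so that it serves for both variables.\<close>

lemma derivation_funpow:
  fixes D :: "'r::{comm_ring_1,ring_char_0} \<Rightarrow> 'r"
  assumes add: "\<And>a b. D (a + b) = D a + D b" and mult: "\<And>a b. D (a * b) = a * D b + b * D a"
    and f: "D f = 1" and g: "\<And>i. i \<in> I \<Longrightarrow> D (g i) = 0" and "finite I"
  shows "(D ^^ q) (\<Sum>i\<in>I. g i * f ^ n i) =
    fact q * (\<Sum>i\<in>I. g i * (of_nat (n i choose q) * f ^ (n i - q)))"
proof -
  have D0: "D 0 = 0" using add[of 0 0] by simp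
  have D1: "D 1 = 0" using mult[of 1 1] by simp
  have Dnat: "D (of_nat k) = 0" for k by (induction k) (simp_all add: D0 D1 add)
  have Dsum: "D (sum h I) = (\<Sum>i\<in>I. D (h i))" for h
    using \<open>finite I\<close> by (induction I rule: finite_induct) (simp_all add: D0 add)
  have Dpow: "D (f ^ k) = of_nat k * f ^ (k - 1)" for k
  proof (induction k)
    case (Suc k)
    then show ?case by (cases k) (simp_all add: mult f algebra_simps)
  qed (simp add: D1)
  show ?thesis
  proof (induction q)
    case (Suc q)
    have "D (fact q * (\<Sum>i\<in>I. g i * (of_nat (n i choose q) * f ^ (n i - q)))) =
        (\<Sum>i\<in>I. fact q * (g i * (of_nat (n i choose q) * (of_nat (n i - q) * f ^ (n i - q - 1)))))"
      using Dnat[of "fact q"] by (simp add: mult Dsum g Dnat Dpow sum_distrib_left)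
    also have "\<dots> = (\<Sum>i\<in>I. fact (Suc q) * (g i * (of_nat (n i choose Suc q) * f ^ (n i - Suc q))))"
    proof (intro sum.cong refl)
      fix i
      \<comment> \<open>Truncation is harmless: for \<open>n i \<le> q\<close> both sides vanish,
        and with them the terms whose exponents are cut off.\<close>
      have "(n i choose q) * (n i - q) = Suc q * (n i choose Suc q)"
        using binomial_absorb_comp[of "n i" q] binomial_absorption[of q "n i"] by (simp add: mult.commute)
      then have h: "of_nat (n i choose q) * of_nat (n i - q) = (of_nat (Suc q) * of_nat (n i choose Suc q) :: 'r)"
        by (metis of_nat_mult)
      have "fact q * (g i * (of_nat (n i choose q) * (of_nat (n i - q) * f ^ (n i - q - 1)))) =
          fact q * g i * (of_nat (n i choose q) * of_nat (n i - q)) * f ^ (n i - Suc q)"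
        by (simp add: mult.assoc)
      also have "\<dots> = fact (Suc q) * (g i * (of_nat (n i choose Suc q) * f ^ (n i - Suc q)))"
        by (simp only: h fact_Suc mult_ac)
      finally show "fact q * (g i * (of_nat (n i choose q) * (of_nat (n i - q) * f ^ (n i - q - 1)))) =
          fact (Suc q) * (g i * (of_nat (n i choose Suc q) * f ^ (n i - Suc q)))" .
    qed
    finally show ?case using Suc by (simp add: sum_distrib_left)
  qed simp
qed

lemma partial_y_add: "partial_y (a + b) = partial_y a + partial_y b"
  by (rule poly_eqI) (simp add: partial_y_def coeff_map_poly pderiv_add)

lemma partial_y_mult: "partial_y (a * b) = a * partial_y b + b * partial_y a"
proof (rule poly_eqI)
  fix n
  \<comment> \<open>The product is commuted so that both convolutions pair \<open>coeff a i\<close>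
    with \<open>coeff b (n - i)\<close>, and the Leibniz rule applies termwise.\<close>
  have "coeff (b * partial_y a) n = (\<Sum>i\<le>n. coeff b (n - i) * pderiv (coeff a i))"
    unfolding mult.commute[of b "partial_y a"] coeff_mult
    by (simp add: partial_y_def coeff_map_poly mult.commute)
  moreover have "pderiv (\<Sum>i\<le>n. coeff a i * coeff b (n - i)) =
      (\<Sum>i\<le>n. pderiv (coeff a i * coeff b (n - i)))"
    using sum_comp_morphism[of pderiv "\<lambda>i. coeff a i * coeff b (n - i)" "{..n}"]
    by (simp add: pderiv_add o_def)
  ultimately show "coeff (partial_y (a * b)) n = coeff (a * partial_y b + b * partial_y a) n"
    by (simp add: partial_y_def coeff_map_poly coeff_mult pderiv_mult sum.distrib)
qed

lemma partial_y_eq_0: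
  "partial_y ((var_x - 1) ^ k * var_z ^ m) = 0"
proof -
  have "(var_x - 1) = [:-1, 1:]" by (simp add: var_x_def one_pCons)
  then have x: "partial_y (var_x - 1) = 0"
    by (simp add: partial_y_def map_poly_pCons pderiv_minus pderiv_1)
  have z: "partial_y var_z = 0"
    by (simp add: partial_y_def var_z_def map_poly_pCons pderiv_pCons)
  have "partial_y (a ^ n) = 0" if "partial_y a = 0" for a n
    by (induction n) (simp_all add: partial_y_mult that, simp add: partial_y_def one_pCons map_poly_pCons)
  then show ?thesis using x z by (simp add: partial_y_mult)
qed

theorem theorem3:
  fixes E :: "'a::linorder set" and \<I> \<I>' :: "'a set set" and p q :: nat
  assumes "matroid_perspective E \<I> \<I>'"
  shows "(partial_x ^^ p) ((partial_y ^^ q) (tutte E \<I> \<I>' var_x var_y var_z)) =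
    fact p * fact q *
    (\<Sum>A | A \<subseteq> E \<and> cr E \<I>' A = p \<and> nl \<I> A = q.
      var_x ^ int_act E \<I>' A * var_y ^ ext_act E \<I> A * var_z ^ nat (rcd E \<I> \<I>' A))"
proof -
  have "finite E" using assms by (simp add: matroid_perspective_def matroid_def)
  then have fin: "finite {A. A \<subseteq> E}" by simp
  let ?r = "\<lambda>A. nat (rcd E \<I> \<I>' A)"
  let ?y = "\<lambda>A. of_nat (nl \<I> A choose q) * (var_y - 1) ^ (nl \<I> A - q)"
  have "(partial_y ^^ q) (tutte E \<I> \<I>' var_x var_y var_z) =
      (partial_y ^^ q) (\<Sum>A | A \<subseteq> E. ((var_x - 1) ^ cr E \<I>' A * var_z ^ ?r A) * (var_y - 1) ^ nl \<I> A)"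
    by (simp add: tutte_def cr_def nl_def mult_ac)
  also have "\<dots> = fact q * (\<Sum>A | A \<subseteq> E. ((var_x - 1) ^ cr E \<I>' A * var_z ^ ?r A) * ?y A)"
  proof (rule derivation_funpow[OF partial_y_add partial_y_mult _ partial_y_eq_0 fin])
    have "var_y - 1 = [:[:-1, 1:]:]" by (simp add: var_y_def one_pCons)
    then show "partial_y (var_y - 1) = 1"
      by (simp add: partial_y_def map_poly_pCons pderiv_pCons one_pCons)
  qed
  also have "\<dots> = (\<Sum>A | A \<subseteq> E. (fact q * ?y A * var_z ^ ?r A) * (var_x - 1) ^ cr E \<I>' A)"
    by (simp add: sum_distrib_left mult_ac)
  finally have "(partial_x ^^ p) ((partial_y ^^ q) (tutte E \<I> \<I>' var_x var_y var_z)) =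
      (pderiv ^^ p) (\<Sum>A | A \<subseteq> E. (fact q * ?y A * var_z ^ ?r A) * (var_x - 1) ^ cr E \<I>' A)"
    by (simp add: partial_x_def)
  also have "\<dots> = fact p * (\<Sum>A | A \<subseteq> E. (fact q * ?y A * var_z ^ ?r A) *
      (of_nat (cr E \<I>' A choose p) * (var_x - 1) ^ (cr E \<I>' A - p)))"
  proof (rule derivation_funpow[OF pderiv_add pderiv_mult _ _ fin])
    show "pderiv (var_x - 1) = 1"
      by (simp add: var_x_def pderiv_diff pderiv_pCons pderiv_1 one_pCons)
    have "pderiv (var_y - 1) = 0" "pderiv var_z = 0"
      by (simp_all add: var_y_def var_z_def pderiv_diff pderiv_pCons)
    moreover have "pderiv (fact q :: poly3) = 0"
      using pderiv_of_nat[where 'a = "int poly poly", of "fact q"] by (simp only: of_nat_fact)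
    ultimately show "pderiv (fact q * ?y A * var_z ^ ?r A) = 0" for A
      by (simp add: pderiv_mult pderiv_power pderiv_of_nat)
  qed
  also have "\<dots> = fact p * fact q * (\<Sum>A | A \<subseteq> E.
      of_nat (cr E \<I>' A choose p) * (var_x - 1) ^ (cr E \<I>' A - p) * ?y A * var_z ^ ?r A)"
    by (simp add: sum_distrib_left mult_ac)
  \<comment> \<open>The remaining sum is the Taylor coefficient at the point (\<open>var_x\<close>,
    \<open>var_y\<close>, \<open>var_z\<close>) of the ring \<open>poly3\<close> itself.\<close>
  finally show ?thesis unfolding tutte_Taylor_coefficient[OF assms] .
qed

end
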